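(* Let $\mathbb K$ be a field of characteristic zero and $E$ a finite-dimensional vector space over $\mathbb K$. In any associative $\mathbb K$-algebra generated by $E$, the following are equivalent: (i) $xyx=0$ for all $x,y\in E$; (ii) $[[x,y],z]=0$ for all $x,y,z\in E$, and $x^3=0$ for all $x\in E$.
   Context: An associative algebra generated by $E$ means an associative $\mathbb K$-algebra $A$ together with a linear map $E\to A$ whose image generates $A$; elements of $E$ are identified with their images in $A$. The bracket is the commutator $[a,b]=ab-ba$. *)

theory Defs
  imports Complex_Main
begin

text \<open>
  The class \<^class>\<open>ring\<close> does not require a unit, so the algebras below may or may not be unital.
\<close>

locale assoc_algebra = vector_space scale
  for scale :: "'k::field \<Rightarrow> 'a::ring \<Rightarrow> 'a" +
  assumes scale_mult_left: "scale c a * b = scale c (a * b)"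
    and scale_mult_right: "a * scale c b = scale c (a * b)"
begin

text \<open>
  If the algebra has a unit, a subalgebra is required to contain it, so that generation means
  generation as a unital algebra; this is implied by generation without using the unit.
  If there is no unit, the last conjunct is vacuous.
\<close>

definition subalgebra :: "'a set \<Rightarrow> bool" where
  "subalgebra S \<longleftrightarrow> subspace S \<and> (\<forall>a\<in>S. \<forall>b\<in>S. a * b \<in> S) \<and>
     (\<forall>e. (\<forall>a. e * a = a \<and> a * e = a) \<longrightarrow> e \<in> S)"

definition generates :: "'a set \<Rightarrow> bool" where
  "generates X \<longleftrightarrow> subalgebra hull X = UNIV"

end

definition commutator :: "'a::ring \<Rightarrow> 'a \<Rightarrow> 'a" where
  "commutator a b = a * b - b * a"

end

theory Submission
  imports Defs
begin

text \<open>
  Linearizing \<open>xyx = 0\<close> gives \<open>xyz + zyx = 0\<close>, and \<open>[[x,y],z] = (xyz + zyx) - (yxz + zxy)\<close>.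
  Conversely, linearizing \<open>x\<^sup>3 = 0\<close> gives \<open>xxy + xyx + yxx = 0\<close>, and adding
  \<open>[[x,y],x] = 2xyx - xxy - yxx = 0\<close> leaves \<open>3xyx = 0\<close>.
\<close>

lemma commutator_commutator:
  "commutator (commutator x y) z = (x * y * z + z * y * x) - (y * x * z + z * x * y)"
  by (simp add: commutator_def algebra_simps)

theorem theorem3:
  fixes scaleE :: "'k::field_char_0 \<Rightarrow> 'e::ab_group_add \<Rightarrow> 'e"
    and scaleA :: "'k \<Rightarrow> 'a::ring \<Rightarrow> 'a"
    and \<phi> :: "'e \<Rightarrow> 'a"
  assumes "\<exists>B. finite_dimensional_vector_space scaleE B"
    and "assoc_algebra scaleA"
    and "Vector_Spaces.linear scaleE scaleA \<phi>"
    and "assoc_algebra.generates scaleA (range \<phi>)"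
  shows "(\<forall>x y. \<phi> x * \<phi> y * \<phi> x = 0) \<longleftrightarrow>
    (\<forall>x y z. commutator (commutator (\<phi> x) (\<phi> y)) (\<phi> z) = 0) \<and>
    (\<forall>x. \<phi> x * \<phi> x * \<phi> x = 0)"
proof -
  interpret A: assoc_algebra scaleA by fact
  interpret \<phi>: Vector_Spaces.linear scaleE scaleA \<phi> by fact
  \<comment> \<open>Characteristic zero is known only for the scalars, and the algebra need not have
    a unit. Repeated sums are therefore rewritten as scalar multiples, where 2 and 3 are nonzero in
    the field.\<close>
  have two: "a = 0" if "a + a = 0" for a :: 'a
  proof -
    have "scaleA 2 a = 0"
      using that A.scale_left_distrib[of 1 1 a] by simp
    then show ?thesis by simp
  qed
  have three: "a = 0" if "a + a + a = 0" for a :: 'a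
  proof -
    have "scaleA 3 a = 0"
      using that A.scale_left_distrib[of 1 1 a] A.scale_left_distrib[of 2 1 a] by simp
    then show ?thesis by simp
  qed
  show ?thesis
  proof (intro iffI conjI allI)
    assume i: "\<forall>x y. \<phi> x * \<phi> y * \<phi> x = 0"
    have skew: "\<phi> x * \<phi> y * \<phi> z + \<phi> z * \<phi> y * \<phi> x = 0" for x y z
    proof -
      \<comment> \<open>Of the four terms in the expansion, the two with equal outer factors vanish
        by \<open>i\<close>; the mixed ones remain.\<close>
      have "\<phi> (z + x) * \<phi> y * \<phi> (z + x) = 0" using i by blast
      with i show ?thesis by (simp add: \<phi>.add distrib_left distrib_right)
    qed
    show "commutator (commutator (\<phi> x) (\<phi> y)) (\<phi> z) = 0" for x y z
      \<comment> \<open>Both bracketed pairs are instances of \<open>skew\<close>, with middle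
        factors \<open>\<phi> y\<close> and \<open>\<phi> x\<close>.\<close>
      by (simp add: commutator_commutator skew)
    show "\<phi> x * \<phi> x * \<phi> x = 0" for x using i by blast
  next
    fix x y
    assume ii: "(\<forall>x y z. commutator (commutator (\<phi> x) (\<phi> y)) (\<phi> z) = 0) \<and>
      (\<forall>x. \<phi> x * \<phi> x * \<phi> x = 0)"
    define a b where "a = \<phi> x" and "b = \<phi> y"
    \<comment> \<open>This is the part of the cube of \<open>a + b\<close> that is linear in
      \<open>b\<close>.\<close>
    let ?s = "a * a * b + a * b * a + b * a * a"
    have cube: "\<phi> z * \<phi> z * \<phi> z = 0" for z using ii by blast
    have b: "b * b * b = 0" using cube[of y] unfolding b_def .
    have plus: "(a + b) * (a + b) * (a + b) = 0"
      using cube[of "x + y"] unfolding a_def b_def \<phi>.add .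
    have minus: "(a - b) * (a - b) * (a - b) = 0"
      using cube[of "x - y"] unfolding a_def b_def \<phi>.diff .
    \<comment> \<open>Subtracting the two cubes keeps only the terms of odd degree in
      \<open>b\<close>, each doubled: the linear part and the cube of \<open>b\<close>.\<close>
    have "?s + ?s = (a + b) * (a + b) * (a + b) - (a - b) * (a - b) * (a - b) - (b * b * b + b * b * b)"
      by (simp add: algebra_simps)
    also have "\<dots> = 0" by (simp only: plus minus b) simp
    finally have s: "?s = 0" by (rule two)
    have c: "commutator (commutator a b) a = 0" using ii unfolding a_def b_def by blast
    have "a * b * a + a * b * a + a * b * a = ?s + commutator (commutator a b) a"
      by (simp add: commutator_def algebra_simps)
    also have "\<dots> = 0" by (simp only: s c) simp
    finally have "a * b * a = 0" by (rule three)
    then show "\<phi> x * \<phi> y * \<phi> x = 0" by (simp add: a_def b_def)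
  qed
qed

end
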